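(* Let $X$ be a real Hilbert space with dual $X'$, let $F:X\to X'$, and for each $u\in X$ let $A(u):X\to X'$ be linear and invertible, with $a(u;v,w):=\langle A(u)v,w\rangle$ and $f(u):=A(u)u-F(u)\in X'$. Suppose that: (F1) there is $L_F>0$ with $|\langle F(u)-F(v),w\rangle|\le L_F\|u-v\|_X\|w\|_X$ for all $u,v,w\in X$; (F2) there is $\nu>0$ with $\nu\|u-v\|_X^2\le\langle F(u)-F(v),u-v\rangle$ for all $u,v\in X$; and that there are constants $\alpha,\beta>0$ independent of $u$ such that $a(u;v,v)\ge\alpha\|v\|_X^2$ and $a(u;v,w)\le\beta\|v\|_X\|w\|_X$ for all $u,v,w\in X$. Let $X_N\subset X$ be a finite-dimensional subspace, let $u_N^0\in X_N$, and let $\{u_N^n\}_{n\ge0}\subset X_N$ be defined by $$a(u_N^n;u_N^{n+1},v)=\langle f(u_N^n),v\rangle\qquad\forall v\in X_N,\ n\ge0.$$ For $n\ge0$ let $\eta(u_N^{n+1},u_N^n)$ be a real number such that $$\sup_{v\in X,\ \|v\|_X=1}\left\{a(u_N^n;u_N^{n+1},v)-\langle f(u_N^n),v\rangle\right\}\le\eta(u_N^{n+1},u_N^n).$$ Then, with $u^\star\in X$ the unique solution of $F(u^\star)=0$ in $X'$, $$\|u^\star-u_N^{n+1}\|_X\le\frac{\beta}{\alpha\nu}\,\eta(u_N^{n+1},u_N^n)+\frac{\beta+L_F}{\nu}\,\|u_N^{n+1}-u_N^n\|_X.$$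
   Context: $\langle\cdot,\cdot\rangle$ denotes the duality pairing in $X'\times X$, and $\|\cdot\|_X$ the norm induced by the inner product of $X$. *)

theory Defs
  imports "HOL-Analysis.Analysis"
begin

text \<open>
  A real Hilbert space is a type of sort \<open>{real_inner, complete_space}\<close>; its dual is the
  type \<open>'a \<Rightarrow>\<^sub>L real\<close> of bounded linear functionals, and the duality pairing is
  \<open>blinfun_apply\<close>.
\<close>

type_synonym 'a dual = "'a \<Rightarrow>\<^sub>L real"

definition a_form ::
    "('a \<Rightarrow> 'a \<Rightarrow> 'a dual) \<Rightarrow> 'a \<Rightarrow> 'a \<Rightarrow> 'a::{real_inner, complete_space} \<Rightarrow> real" where
  "a_form A u v w = blinfun_apply (A u v) w"

definition f_rhs ::
    "('a \<Rightarrow> 'a \<Rightarrow> 'a dual) \<Rightarrow> ('a \<Rightarrow> 'a dual) \<Rightarrow> 'a::{real_inner, complete_space} \<Rightarrow> 'a dual" where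
  "f_rhs A F u = A u u - F u"

text \<open>
  Supremum over the unit sphere. The sphere is empty exactly when the space is \<open>{0}\<close>. There
  the supremum is taken to be \<open>0\<close>, which is the dual norm of the only functional; the value of
  \<open>Sup {}\<close> on the reals carries no information.
\<close>

definition unit_sphere_sup :: "('a::{real_inner, complete_space} \<Rightarrow> real) \<Rightarrow> real" where
  "unit_sphere_sup g =
     (if {v::'a. norm v = 1} = {} then 0 else (SUP v\<in>{v. norm v = 1}. g v))"

end

theory Submission
  imports Defs
begin

text \<open>
  Existence and uniqueness of the zero of \<open>F\<close> is Zarantonello's theorem. The Riesz isomorphism
  \<open>R\<close> turns \<open>F\<close> into a vector field on the space, and for a small step \<open>t\<close> the map
  \<open>v \<mapsto> v - t R(F v)\<close> is a contraction, because strong monotonicity contributes a decrease of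
  first order in \<open>t\<close> and Lipschitz continuity an increase of second order. Its unique fixed
  point is the unique zero of \<open>F\<close>. The Riesz representation theorem is itself obtained by
  minimising the quadratic energy \<open>\<parallel>v\<parallel>\<^sup>2 - 2 l v\<close>.

  For the estimate, put \<open>e = u\<^sup>\<star> - u\<^sub>N\<^bsup>n+1\<^esup>\<close> and let
  \<open>r v = a(u\<^sub>N\<^sup>n; u\<^sub>N\<^bsup>n+1\<^esup>, v) - \<langle>f(u\<^sub>N\<^sup>n), v\<rangle>\<close> be the residual of the linearised problem. Since
  \<open>f(w) = A(w)w - F(w)\<close>, the term \<open>-\<langle>F(u\<^sub>N\<^sup>n), e\<rangle>\<close> equals
  \<open>a(u\<^sub>N\<^sup>n; u\<^sub>N\<^bsup>n+1\<^esup> - u\<^sub>N\<^sup>n, e) - r e\<close>, and hence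
  \<open>\<nu> \<parallel>e\<parallel>\<^sup>2 \<le> \<langle>F(u\<^sup>\<star>) - F(u\<^sub>N\<^bsup>n+1\<^esup>), e\<rangle>
    = \<langle>F(u\<^sub>N\<^sup>n) - F(u\<^sub>N\<^bsup>n+1\<^esup>), e\<rangle> + a(u\<^sub>N\<^sup>n; u\<^sub>N\<^bsup>n+1\<^esup> - u\<^sub>N\<^sup>n, e) - r e\<close>.
  The three terms on the right are bounded by the Lipschitz condition, by boundedness of the form
  and by the estimator. This yields the factor \<open>1 / \<nu>\<close> in front of the estimator, and
  \<open>1 / \<nu> \<le> \<beta> / (\<alpha> \<nu>)\<close> because coercivity and boundedness
  force \<open>\<alpha> \<le> \<beta>\<close> on a nontrivial space.
\<close>

section \<open>The Riesz representation theorem\<close>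

text \<open>
  The energy \<open>J v = \<parallel>v\<parallel>\<^sup>2 - 2 l v\<close> is bounded below by \<open>-\<parallel>l\<parallel>\<^sup>2\<close>. The parallelogram identity
  bounds the distance of two points by the excess of their energies over the infimum, so a
  minimising sequence is Cauchy; a minimiser \<open>x\<close> satisfies the Euler equation \<open>l h = x \<bullet> h\<close>.
\<close>

lemma riesz_representation:
  fixes l :: "'a::{real_inner, complete_space} dual"
  shows "\<exists>x. \<forall>h. blinfun_apply l h = x \<bullet> h"
proof -
  define J where "J v = v \<bullet> v - 2 * blinfun_apply l v" for v
  have J_lower: "J v \<ge> - (norm l)\<^sup>2" for v
  proof -
    have "blinfun_apply l v \<le> norm l * norm v"
      using norm_blinfun[of l v] by simp
    moreover have "2 * (norm l * norm v) \<le> (norm v)\<^sup>2 + (norm l)\<^sup>2"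
      using sum_squares_bound[of "norm l" "norm v"] by simp
    ultimately show ?thesis
      unfolding J_def dot_square_norm by linarith
  qed
  then have J_bdd: "bdd_below (range J)"
    by (auto simp: bdd_below_def)
  define m where "m = Inf (range J)"
  have m_le: "m \<le> J v" for v
    unfolding m_def using J_bdd by (simp add: cInf_lower)
  have "\<exists>v. J v < m + inverse (real (Suc n))" for n
    using cInf_lessD[of "range J" "m + inverse (real (Suc n))"] by (auto simp: m_def)
  then obtain s where s: "\<And>n. J (s n) < m + inverse (real (Suc n))"
    by metis
  have parallelogram: "(norm (v - w))\<^sup>2 = 2 * J v + 2 * J w - 4 * J ((1/2) *\<^sub>R (v + w))" for v w
    unfolding J_def power2_norm_eq_inner
    by (simp add: inner_simps inner_commute blinfun.add_right blinfun.scaleR_right field_simps)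
  have s_dist: "(norm (s i - s j))\<^sup>2 < 2 * inverse (real (Suc i)) + 2 * inverse (real (Suc j))" for i j
    using parallelogram[of "s i" "s j"] s[of i] s[of j] m_le[of "(1/2) *\<^sub>R (s i + s j)"] by linarith
  have "Cauchy s"
  proof (rule metric_CauchyI)
    fix e :: real assume "e > 0"
    then obtain N where N: "inverse (real (Suc N)) < e\<^sup>2 / 4"
      using reals_Archimedean[of "e\<^sup>2 / 4"] by auto
    have tail: "inverse (real (Suc i)) < e\<^sup>2 / 4" if "i \<ge> N" for i
    proof -
      have "inverse (real (Suc i)) \<le> inverse (real (Suc N))"
        using that by (intro le_imp_inverse_le) auto
      then show ?thesis
        using N by linarith
    qed
    have "dist (s i) (s j) < e" if "i \<ge> N" "j \<ge> N" for i j
    proof -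
      have "(norm (s i - s j))\<^sup>2 < e\<^sup>2"
        using s_dist[of i j] tail[OF that(1)] tail[OF that(2)] by linarith
      then show ?thesis
        using \<open>e > 0\<close> by (simp add: dist_norm power_less_imp_less_base)
    qed
    then show "\<exists>M. \<forall>i\<ge>M. \<forall>j\<ge>M. dist (s i) (s j) < e"
      by blast
  qed
  then obtain x where x: "s \<longlonglongrightarrow> x"
    using Cauchy_convergent convergent_def by blast
  have "(\<lambda>n. J (s n)) \<longlonglongrightarrow> J x"
    unfolding J_def by (intro tendsto_intros x)
  moreover have "(\<lambda>n. m + inverse (real (Suc n))) \<longlonglongrightarrow> m + 0"
    by (intro tendsto_intros LIMSEQ_inverse_real_of_nat)
  ultimately have "J x \<le> m + 0"
    using s by (intro LIMSEQ_le) (auto intro: less_imp_le)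
  then have x_min: "J x \<le> J v" for v
    using m_le[of v] by linarith
  have "blinfun_apply l h = x \<bullet> h" for h
  proof (cases "h = 0")
    case False
    define d where "d = x \<bullet> h - blinfun_apply l h"
    \<comment> \<open>\<open>J\<close> is quadratic along the line \<open>x + t h\<close>; the step that minimises it there lowers the
      energy by \<open>d\<^sup>2 / (h \<bullet> h)\<close>.\<close>
    have "J (x + (- d / (h \<bullet> h)) *\<^sub>R h) = J x - d\<^sup>2 / (h \<bullet> h)"
    proof -
      have expand: "J (x + t *\<^sub>R h) = J x + 2 * t * d + t\<^sup>2 * (h \<bullet> h)" for t
        by (simp add: J_def d_def inner_simps inner_commute blinfun.add_right blinfun.scaleR_right
            algebra_simps power2_eq_square)
      show ?thesis
        unfolding expand using False by (simp add: field_simps power2_eq_square)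
    qed
    then have "d\<^sup>2 / (h \<bullet> h) \<le> 0"
      using x_min[of "x + (- d / (h \<bullet> h)) *\<^sub>R h"] by linarith
    moreover have "h \<bullet> h > 0"
      using False by simp
    ultimately have "d\<^sup>2 \<le> 0"
      by (simp add: divide_le_0_iff)
    then show ?thesis
      by (simp add: d_def)
  qed simp
  then show ?thesis
    by blast
qed

section \<open>Zeros of strongly monotone Lipschitz maps\<close>

text \<open>
  This is Zarantonello's theorem. With \<open>d = v - w\<close> and \<open>r = R(F v) - R(F w)\<close>,
  \<open>\<parallel>d - t r\<parallel>\<^sup>2 = \<parallel>d\<parallel>\<^sup>2 - 2 t (r \<bullet> d) + t\<^sup>2 \<parallel>r\<parallel>\<^sup>2\<close>, and a Lipschitz constant \<open>K\<close> gives the factor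
  \<open>1 - 2 t \<nu> + t\<^sup>2 K\<^sup>2\<close>, which is smallest at \<open>t = \<nu> / K\<^sup>2\<close>.
\<close>

lemma strongly_monotone_lipschitz_unique_zero:
  fixes F :: "'a::{real_inner, complete_space} \<Rightarrow> 'a dual"
  assumes L_pos: "L > 0"
    and lipschitz: "\<And>v w z. \<bar>blinfun_apply (F v - F w) z\<bar> \<le> L * norm (v - w) * norm z"
    and nu_pos: "\<nu> > 0"
    and monotone: "\<And>v w. \<nu> * (norm (v - w))\<^sup>2 \<le> blinfun_apply (F v - F w) (v - w)"
  shows "\<exists>!x. F x = 0"
proof -
  obtain R :: "'a dual \<Rightarrow> 'a" where R: "\<And>l h. blinfun_apply l h = R l \<bullet> h"
    using riesz_representation by metis
  \<comment> \<open>Enlarging the Lipschitz constant beyond \<open>\<nu>\<close> makes \<open>1 - (\<nu> / K)\<^sup>2\<close> nonnegative; in the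
    trivial space \<open>L\<close> may be smaller than \<open>\<nu>\<close>.\<close>
  define K where "K = L + \<nu>"
  have K: "K > 0" "\<nu> < K" "L \<le> K"
    using L_pos nu_pos by (auto simp: K_def)
  define t where "t = \<nu> / K\<^sup>2"
  have t_pos: "t > 0"
    using nu_pos K by (simp add: t_def)
  define T where "T v = v - t *\<^sub>R R (F v)" for v
  define c where "c = sqrt (1 - (\<nu> / K)\<^sup>2)"
  have ratio: "0 < (\<nu> / K)\<^sup>2" "(\<nu> / K)\<^sup>2 < 1"
    using nu_pos K by (auto simp: power_less_one_iff abs_square_less_1)
  have c: "0 \<le> c" "c < 1" "c\<^sup>2 = 1 - (\<nu> / K)\<^sup>2"
    using ratio by (simp_all only: c_def) simp_all
  have "dist (T v) (T w) \<le> c * dist v w" for v w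
  proof -
    define d where "d = v - w"
    define r where "r = R (F v) - R (F w)"
    have r: "r \<bullet> z = blinfun_apply (F v - F w) z" for z
      by (simp add: r_def blinfun.diff_left inner_diff_left flip: R)
    have "norm r * norm r \<le> L * norm d * norm r"
      using lipschitz[of v w r] r[of r] by (simp add: d_def norm_eq_square power2_norm_eq_inner
          flip: power2_eq_square)
    then have "norm r \<le> L * norm d"
      using L_pos by (cases "r = 0") auto
    also have "\<dots> \<le> K * norm d"
      using K by (intro mult_right_mono) auto
    finally have r_norm: "(norm r)\<^sup>2 \<le> K\<^sup>2 * (norm d)\<^sup>2"
      by (metis norm_ge_zero power_mono power_mult_distrib)
    have r_d: "\<nu> * (norm d)\<^sup>2 \<le> r \<bullet> d"
      using monotone[of v w] by (simp add: r d_def)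
    have r_d': "2 * t * (\<nu> * (norm d)\<^sup>2) \<le> 2 * t * (r \<bullet> d)"
      by (rule mult_left_mono[OF r_d]) (use t_pos in simp)
    have r_norm': "t\<^sup>2 * (norm r)\<^sup>2 \<le> t\<^sup>2 * (K\<^sup>2 * (norm d)\<^sup>2)"
      by (rule mult_left_mono[OF r_norm]) simp
    have "(norm (T v - T w))\<^sup>2 = (norm (d - t *\<^sub>R r))\<^sup>2"
      by (simp add: T_def d_def r_def algebra_simps)
    also have "\<dots> = (norm d)\<^sup>2 - 2 * t * (r \<bullet> d) + t\<^sup>2 * (norm r)\<^sup>2"
      unfolding power2_norm_eq_inner
      by (simp add: inner_simps inner_commute algebra_simps power2_eq_square)
    also have "\<dots> \<le> (norm d)\<^sup>2 - 2 * t * (\<nu> * (norm d)\<^sup>2) + t\<^sup>2 * (K\<^sup>2 * (norm d)\<^sup>2)"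
      using r_d' r_norm' by linarith
    also have "\<dots> = (1 - (\<nu> / K)\<^sup>2) * (norm d)\<^sup>2"
    proof -
      have rate: "t * \<nu> = (\<nu> / K)\<^sup>2" "t\<^sup>2 * K\<^sup>2 = (\<nu> / K)\<^sup>2"
        using K(1) by (simp_all add: t_def power2_eq_square)
      have "(norm d)\<^sup>2 - 2 * t * (\<nu> * (norm d)\<^sup>2) + t\<^sup>2 * (K\<^sup>2 * (norm d)\<^sup>2)
          = (norm d)\<^sup>2 - 2 * (t * \<nu>) * (norm d)\<^sup>2 + (t\<^sup>2 * K\<^sup>2) * (norm d)\<^sup>2"
        by (simp only: mult.assoc)
      also have "\<dots> = (1 - (\<nu> / K)\<^sup>2) * (norm d)\<^sup>2"
        unfolding rate by (simp only: left_diff_distrib)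
      finally show ?thesis .
    qed
    also have "\<dots> = (c * norm d)\<^sup>2"
      by (simp only: c(3) power_mult_distrib)
    finally have "norm (T v - T w) \<le> c * norm d"
      by (rule power2_le_imp_le) (simp add: c(1))
    then show ?thesis
      by (simp add: dist_norm d_def)
  qed
  then have "\<exists>!x. T x = x"
    by (intro banach_fix_type[OF c(1,2)]) blast
  have R_zero: "R 0 = 0"
    using R[of 0 "R 0"] by simp
  have "T x = x \<longleftrightarrow> F x = 0" for x
  proof
    assume "T x = x"
    then have "R (F x) = 0"
      using t_pos by (simp add: T_def)
    then show "F x = 0"
      by (intro blinfun_eqI) (simp add: R R_zero)
  next
    assume "F x = 0"
    then show "T x = x"
      by (simp add: T_def R_zero)
  qed
  with \<open>\<exists>!x. T x = x\<close> show ?thesis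
    by simp
qed

section \<open>The a posteriori error estimate\<close>

text \<open>
  The supremum of a functional over the unit sphere is its dual norm. The sphere is symmetric, so
  one of the values \<open>\<pm> r v\<close> is nonnegative, and the supremum bounds \<open>r\<close> everywhere by
  homogeneity.
\<close>

lemma unit_sphere_sup_bound:
  fixes r :: "'a::{real_inner, complete_space} dual"
  assumes sup_le: "unit_sphere_sup (blinfun_apply r) \<le> \<eta>"
  shows "\<eta> \<ge> 0" and "blinfun_apply r w \<le> \<eta> * norm w"
proof -
  have unit: "blinfun_apply r v \<le> \<eta>" if "norm v = 1" for v
  proof -
    have "bdd_above (blinfun_apply r ` {v. norm v = 1})"
    proof (rule bdd_aboveI2)
      fix v :: 'a assume "v \<in> {v. norm v = 1}"
      then show "blinfun_apply r v \<le> norm r"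
        using norm_blinfun[of r v] by simp
    qed
    then have "blinfun_apply r v \<le> (SUP v\<in>{v. norm v = 1}. blinfun_apply r v)"
      using that by (intro cSUP_upper) auto
    also have "\<dots> \<le> \<eta>"
      using sup_le that by (auto simp: unit_sphere_sup_def split: if_splits)
    finally show ?thesis .
  qed
  show "\<eta> \<ge> 0"
  proof (cases "{v::'a. norm v = 1} = {}")
    case True
    then show ?thesis
      using sup_le by (simp add: unit_sphere_sup_def)
  next
    case False
    then obtain v :: 'a where "norm v = 1"
      by auto
    then show ?thesis
      using unit[of v] unit[of "- v"] by (simp add: blinfun.minus_right)
  qed
  show "blinfun_apply r w \<le> \<eta> * norm w"
  proof (cases "w = 0")
    case False
    then have "blinfun_apply r ((1 / norm w) *\<^sub>R w) \<le> \<eta>"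
      by (intro unit) simp
    then show ?thesis
      using False by (simp add: blinfun.scaleR_right field_simps)
  qed simp
qed

text \<open>
  Strong monotonicity bounds the error by \<open>F w'\<close> tested with the error itself. Passing from
  \<open>F w'\<close> to \<open>F w\<close> costs \<open>L\<close> times the increment \<open>w' - w\<close>; passing from \<open>F w\<close> to the residual
  of the linear problem for \<open>w'\<close> costs \<open>\<beta>\<close> times the increment. In the iteration \<open>B\<close> is the
  operator \<open>A(w)\<close>.
\<close>

lemma zarantonello_step_error:
  fixes F :: "'a::{real_inner, complete_space} \<Rightarrow> 'a dual" and B :: "'a \<Rightarrow> 'a dual"
  assumes B_linear: "linear B"
    and B_bounded: "\<And>v z. blinfun_apply (B v) z \<le> \<beta> * norm v * norm z"
    and lipschitz: "\<And>v w z. \<bar>blinfun_apply (F v - F w) z\<bar> \<le> L * norm (v - w) * norm z"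
    and nu_pos: "\<nu> > 0"
    and monotone: "\<And>v w. \<nu> * (norm (v - w))\<^sup>2 \<le> blinfun_apply (F v - F w) (v - w)"
    and residual: "\<And>v. blinfun_apply (B w' - (B w - F w)) v \<le> \<eta> * norm v"
    and eta_nonneg: "\<eta> \<ge> 0" and L_nonneg: "L \<ge> 0" and beta_nonneg: "\<beta> \<ge> 0"
    and zero: "F x = 0"
  shows "norm (x - w') \<le> \<eta> / \<nu> + (\<beta> + L) / \<nu> * norm (w' - w)"
proof -
  define e where "e = x - w'"
  have "\<nu> * (norm e)\<^sup>2 \<le> blinfun_apply (F x - F w') e"
    using monotone[of x w'] by (simp add: e_def)
  also have "\<dots> = blinfun_apply (F w - F w') e + blinfun_apply (B (w' - w)) e
      + blinfun_apply (B w' - (B w - F w)) (- e)"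
    by (simp add: zero linear_diff[OF B_linear] blinfun.diff_left blinfun.minus_left
        blinfun.minus_right)
  also have "\<dots> \<le> L * norm (w' - w) * norm e + \<beta> * norm (w' - w) * norm e + \<eta> * norm e"
    using lipschitz[of w w' e] B_bounded[of "w' - w" e] residual[of "- e"]
    by (simp add: norm_minus_commute)
  finally have "(\<nu> * norm e) * norm e \<le> (\<eta> + (\<beta> + L) * norm (w' - w)) * norm e"
    by (simp add: power2_eq_square algebra_simps)
  then have "\<nu> * norm e \<le> \<eta> + (\<beta> + L) * norm (w' - w)"
    using eta_nonneg L_nonneg beta_nonneg by (cases "e = 0") auto
  then show ?thesis
    using nu_pos by (simp add: e_def field_simps)
qed

theorem theorem3p1:
  fixes F :: "'a::{real_inner, complete_space} \<Rightarrow> 'a dual"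
    and A :: "'a \<Rightarrow> 'a \<Rightarrow> 'a dual"
    and L\<^sub>F \<nu> \<alpha> \<beta> :: real
    and X\<^sub>N :: "'a set"
    and u :: "nat \<Rightarrow> 'a"
    and \<eta> :: "'a \<Rightarrow> 'a \<Rightarrow> real"
  assumes A_linear: "\<And>w. linear (A w)"
    and A_invertible: "\<And>w. bij (A w)"
    and L_pos: "L\<^sub>F > 0"
    and F1: "\<And>v w z. \<bar>blinfun_apply (F v - F w) z\<bar> \<le> L\<^sub>F * norm (v - w) * norm z"
    and nu_pos: "\<nu> > 0"
    and F2: "\<And>v w. \<nu> * (norm (v - w))\<^sup>2 \<le> blinfun_apply (F v - F w) (v - w)"
    and alpha_pos: "\<alpha> > 0"
    and beta_pos: "\<beta> > 0"
    and coercive: "\<And>w v. a_form A w v v \<ge> \<alpha> * (norm v)\<^sup>2"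
    and bounded: "\<And>w v z. a_form A w v z \<le> \<beta> * norm v * norm z"
    and XN_subspace: "subspace X\<^sub>N"
    and XN_finite_dim: "\<exists>B. finite B \<and> span B = X\<^sub>N"
    and u_in_XN: "\<And>n. u n \<in> X\<^sub>N"
    and iteration: "\<And>n v. v \<in> X\<^sub>N \<Longrightarrow>
          a_form A (u n) (u (Suc n)) v = blinfun_apply (f_rhs A F (u n)) v"
    and estimator: "\<And>n. unit_sphere_sup
            (\<lambda>v. a_form A (u n) (u (Suc n)) v - blinfun_apply (f_rhs A F (u n)) v)
          \<le> \<eta> (u (Suc n)) (u n)"
  shows "(\<exists>!u_star. F u_star = 0) \<and>
    (\<forall>u_star. F u_star = 0 \<longrightarrow>
      (\<forall>n. norm (u_star - u (Suc n))
         \<le> \<beta> / (\<alpha> * \<nu>) * \<eta> (u (Suc n)) (u n)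
           + (\<beta> + L\<^sub>F) / \<nu> * norm (u (Suc n) - u n)))"
proof (intro conjI allI impI)
  show "\<exists>!u_star. F u_star = 0"
    using L_pos F1 nu_pos F2 by (rule strongly_monotone_lipschitz_unique_zero)
next
  fix u_star n
  assume zero: "F u_star = 0"
  define E where "E = \<eta> (u (Suc n)) (u n)"
  have "unit_sphere_sup (blinfun_apply (A (u n) (u (Suc n)) - (A (u n) (u n) - F (u n)))) \<le> E"
    using estimator[of n] by (simp add: E_def a_form_def f_rhs_def flip: blinfun.diff_left)
  note E = unit_sphere_sup_bound[OF this]
  have step: "norm (u_star - u (Suc n)) \<le> E / \<nu> + (\<beta> + L\<^sub>F) / \<nu> * norm (u (Suc n) - u n)"
    using A_linear bounded[unfolded a_form_def] F1 nu_pos F2 E(2) E(1) less_imp_le[OF L_pos]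
      less_imp_le[OF beta_pos] zero
    by (rule zarantonello_step_error)
  have "norm (u_star - u (Suc n))
      \<le> \<beta> / (\<alpha> * \<nu>) * E + (\<beta> + L\<^sub>F) / \<nu> * norm (u (Suc n) - u n)"
  proof (cases "u_star = u (Suc n)")
    \<comment> \<open>With zero error only the sign of the right-hand side matters. Otherwise the error is a
      nonzero vector, at which coercivity and boundedness can be compared.\<close>
    case True
    then show ?thesis
      using E(1) alpha_pos beta_pos nu_pos L_pos by simp
  next
    case False
    then have "norm (u_star - u (Suc n)) > 0"
      by simp
    moreover have "\<alpha> * (norm (u_star - u (Suc n)))\<^sup>2 \<le> \<beta> * (norm (u_star - u (Suc n)))\<^sup>2"
      using order_trans[OF coercive bounded] by (simp add: power2_eq_square mult.assoc)
    ultimately have "\<alpha> \<le> \<beta>"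
      by simp
    then have "E / \<nu> * 1 \<le> E / \<nu> * (\<beta> / \<alpha>)"
      using E(1) nu_pos alpha_pos by (intro mult_left_mono) auto
    then show ?thesis
      using step by (simp add: mult.commute)
  qed
  then show "norm (u_star - u (Suc n))
      \<le> \<beta> / (\<alpha> * \<nu>) * \<eta> (u (Suc n)) (u n)
        + (\<beta> + L\<^sub>F) / \<nu> * norm (u (Suc n) - u n)"
    by (simp add: E_def)
qed

end
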